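(* Let $\mathcal{I}_1,\mathcal{I}_2\in\mathcal{I}_n(\Omega,\mathcal{U})$. Then the following statements are equivalent: (1) $\mathcal{I}_1\sim_s\mathcal{I}_2$. (2) There is an invertible operator $X\in\mathcal{U}$ such that $$X\,D^I\mathcal{I}_1(\lambda)\,\overline{D}^J\mathcal{I}_1(\lambda)=D^I\mathcal{I}_2(\lambda)\,\overline{D}^J\mathcal{I}_2(\lambda)\,X,\qquad \lambda\in\Omega,\ I,J\in\mathbb{Z}_+^m.$$
   Context: $\Omega\subseteq\mathbb{C}^m$ is a domain, $\partial_i=\partial/\partial\lambda_i$, $\overline\partial_j=\partial/\partial\overline\lambda_j$; for $I=(i_1,\dots,i_m)\in\mathbb{Z}_+^m$, $D^I=\partial_1^{i_1}\cdots\partial_m^{i_m}$ and $\overline D^I=\overline\partial_1^{i_1}\cdots\overline\partial_m^{i_m}$. $B$ is a unital $C^*$-algebra, $l^2(\mathbb{N},B)=\{(a_i)_{i\in\mathbb{N}}: a_i\in B,\ \sum_i\|a_i\|^2<\infty\}$ with $B$-valued inner product $\langle a,b\rangle=\sum_i b_i^*a_i$, and $\mathcal{U}$ is the algebra of bounded linear operators on $l^2(\mathbb{N},B)$. $\mathcal{I}_n(\Omega,\mathcal{U})$ is the set of maps $\mathcal{I}:\Omega\to\mathcal{U}$ of the form $\mathcal{I}(\lambda)=F(\lambda)(G^*(\lambda)F(\lambda))^{-1}G^*(\lambda)$, where $F_1,\dots,F_n,G_1,\dots,G_n:\Omega\to l^2(\mathbb{N},B)$ are holomorphic, $F(\lambda)\xi=\sum_iF_i(\lambda)\xi_i$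 for $\xi\in B^n$, $G^*(\lambda)x=(\langle x,G_i(\lambda)\rangle)_{i=1}^n$, and $G^*(\lambda)F(\lambda)=(\langle F_j(\lambda),G_i(\lambda)\rangle)_{i,j}$ is invertible for every $\lambda$. $\mathcal{I}_1\sim_s\mathcal{I}_2$ means there is an invertible $X\in\mathcal{U}$ with $X\mathcal{I}_1(\lambda)=\mathcal{I}_2(\lambda)X$ for all $\lambda\in\Omega$. *)

theory Defs
  imports "HOL-Analysis.Analysis"
begin

section \<open>Complex normed spaces and unital C*-algebras\<close>

class complex_vector = real_vector +
  fixes scaleC :: "complex \<Rightarrow> 'a \<Rightarrow> 'a"  (infixr "*\<^sub>C" 75)
  assumes scaleC_add_right: "c *\<^sub>C (x + y) = c *\<^sub>C x + c *\<^sub>C y"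
    and scaleC_add_left: "(c + d) *\<^sub>C x = c *\<^sub>C x + d *\<^sub>C x"
    and scaleC_scaleC: "c *\<^sub>C d *\<^sub>C x = (c * d) *\<^sub>C x"
    and scaleC_of_real: "complex_of_real r *\<^sub>C x = r *\<^sub>R x"

class complex_normed_vector = complex_vector + real_normed_vector +
  assumes norm_scaleC: "norm (c *\<^sub>C x) = norm c * norm x"

class unital_cstar_algebra = complex_normed_vector + real_normed_algebra_1 + banach +
  fixes star :: "'a \<Rightarrow> 'a"
  assumes scaleC_mult_left: "(c *\<^sub>C x) * y = c *\<^sub>C (x * y)"
    and scaleC_mult_right: "x * (c *\<^sub>C y) = c *\<^sub>C (x * y)"
    and star_add: "star (x + y) = star x + star y"
    and star_scaleC: "star (c *\<^sub>C x) = cnj c *\<^sub>C star x"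
    and star_mult: "star (x * y) = star y * star x"
    and star_star: "star (star x) = x"
    and cstar_identity: "norm (star x * x) = (norm x)\<^sup>2"


section \<open>The space of square-summable sequences\<close>

typedef (overloaded) 'b ell2 = "{a :: nat \<Rightarrow> 'b::real_normed_vector. summable (\<lambda>i. (norm (a i))\<^sup>2)}"
  morphisms ell2_nth Abs_ell2
  by (rule exI[of _ "\<lambda>_. 0"]) simp

setup_lifting type_definition_ell2

lemma square_summable_add:
  fixes a b :: "nat \<Rightarrow> 'b::real_normed_vector"
  assumes a: "summable (\<lambda>i. (norm (a i))\<^sup>2)" and b: "summable (\<lambda>i. (norm (b i))\<^sup>2)"
  shows "summable (\<lambda>i. (norm (a i + b i))\<^sup>2)"
proof (rule summable_comparison_test)
  have "(norm (a i + b i))\<^sup>2 \<le> 2 * (norm (a i))\<^sup>2 + 2 * (norm (b i))\<^sup>2" for i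
  proof -
    have "(norm (a i + b i))\<^sup>2 \<le> (norm (a i) + norm (b i))\<^sup>2"
      by (intro power_mono norm_triangle_ineq) simp
    also have "\<dots> \<le> 2 * (norm (a i))\<^sup>2 + 2 * (norm (b i))\<^sup>2"
      using zero_le_power2[of "norm (a i) - norm (b i)"]
      by (simp add: power2_eq_square algebra_simps)
    finally show ?thesis .
  qed
  then show "\<exists>N. \<forall>i\<ge>N. norm ((norm (a i + b i))\<^sup>2) \<le> 2 * (norm (a i))\<^sup>2 + 2 * (norm (b i))\<^sup>2"
    by simp
  show "summable (\<lambda>i. 2 * (norm (a i))\<^sup>2 + 2 * (norm (b i))\<^sup>2)"
    by (intro summable_add summable_mult a b)
qed

lemma square_summable_minkowski:
  fixes a b :: "nat \<Rightarrow> 'b::real_normed_vector"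
  assumes a: "summable (\<lambda>i. (norm (a i))\<^sup>2)" and b: "summable (\<lambda>i. (norm (b i))\<^sup>2)"
  shows "sqrt (\<Sum>i. (norm (a i + b i))\<^sup>2) \<le> sqrt (\<Sum>i. (norm (a i))\<^sup>2) + sqrt (\<Sum>i. (norm (b i))\<^sup>2)"
proof (rule LIMSEQ_le_const2)
  show "(\<lambda>n. sqrt (\<Sum>i<n. (norm (a i + b i))\<^sup>2)) \<longlonglongrightarrow> sqrt (\<Sum>i. (norm (a i + b i))\<^sup>2)"
    by (intro tendsto_real_sqrt summable_LIMSEQ square_summable_add a b)
  have "sqrt (\<Sum>i<n. (norm (a i + b i))\<^sup>2)
      \<le> sqrt (\<Sum>i. (norm (a i))\<^sup>2) + sqrt (\<Sum>i. (norm (b i))\<^sup>2)" for n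
  proof -
    have "sqrt (\<Sum>i<n. (norm (a i + b i))\<^sup>2) \<le> L2_set (\<lambda>i. norm (a i) + norm (b i)) {..<n}"
      unfolding L2_set_def
      by (intro real_sqrt_le_mono sum_mono power_mono norm_triangle_ineq) simp
    also have "\<dots> \<le> L2_set (\<lambda>i. norm (a i)) {..<n} + L2_set (\<lambda>i. norm (b i)) {..<n}"
      by (rule L2_set_triangle_ineq)
    also have "\<dots> \<le> sqrt (\<Sum>i. (norm (a i))\<^sup>2) + sqrt (\<Sum>i. (norm (b i))\<^sup>2)"
      unfolding L2_set_def
      by (intro add_mono real_sqrt_le_mono sum_le_suminf a b) auto
    finally show ?thesis .
  qed
  then show "\<exists>N. \<forall>n\<ge>N. sqrt (\<Sum>i<n. (norm (a i + b i))\<^sup>2)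
      \<le> sqrt (\<Sum>i. (norm (a i))\<^sup>2) + sqrt (\<Sum>i. (norm (b i))\<^sup>2)"
    by blast
qed

instantiation ell2 :: (real_normed_vector) real_vector
begin

lift_definition zero_ell2 :: "'a ell2" is "\<lambda>_. 0"
  by simp
lift_definition plus_ell2 :: "'a ell2 \<Rightarrow> 'a ell2 \<Rightarrow> 'a ell2" is "\<lambda>a b i. a i + b i"
  by (rule square_summable_add)
lift_definition uminus_ell2 :: "'a ell2 \<Rightarrow> 'a ell2" is "\<lambda>a i. - a i"
  by simp
lift_definition minus_ell2 :: "'a ell2 \<Rightarrow> 'a ell2 \<Rightarrow> 'a ell2" is "\<lambda>a b i. a i - b i"
  subgoal for a b using square_summable_add[of a "\<lambda>i. - b i"] by simp
  done
lift_definition scaleR_ell2 :: "real \<Rightarrow> 'a ell2 \<Rightarrow> 'a ell2" is "\<lambda>r a i. r *\<^sub>R a i"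
  by (simp add: power_mult_distrib summable_mult)

instance
  by standard (transfer; simp add: fun_eq_iff algebra_simps)+

end

text \<open>The norm is \<open>(\<Sum>\<^sub>i \<parallel>a\<^sub>i\<parallel>\<^sup>2)\<^bsup>1/2\<^esup>\<close>, for which the space is complete and the \<open>B\<close>-valued inner product
  below is bounded. In general it is larger than the norm \<open>\<parallel>\<langle>a, a\<rangle>\<parallel>\<^bsup>1/2\<^esup>\<close>, for which the
  set of sequences with \<open>\<Sum>\<^sub>i \<parallel>a\<^sub>i\<parallel>\<^sup>2 < \<infinity>\<close> need not be complete.\<close>

instantiation ell2 :: (real_normed_vector) real_normed_vector
begin

lift_definition norm_ell2 :: "'a ell2 \<Rightarrow> real" is "\<lambda>a. sqrt (\<Sum>i. (norm (a i))\<^sup>2)" .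

definition dist_ell2 :: "'a ell2 \<Rightarrow> 'a ell2 \<Rightarrow> real"
  where "dist_ell2 a b = norm (a - b)"
definition sgn_ell2 :: "'a ell2 \<Rightarrow> 'a ell2"
  where "sgn_ell2 a = inverse (norm a) *\<^sub>R a"
definition uniformity_ell2 :: "('a ell2 \<times> 'a ell2) filter"
  where "uniformity_ell2 = (INF e\<in>{0<..}. principal {(x, y). dist x y < e})"
definition open_ell2 :: "'a ell2 set \<Rightarrow> bool"
  where "open_ell2 U \<longleftrightarrow> (\<forall>x\<in>U. eventually (\<lambda>(x', y). x' = x \<longrightarrow> y \<in> U) uniformity)"

instance
proof
  fix a b :: "'a ell2" and r :: real
  show "dist a b = norm (a - b)" by (rule dist_ell2_def)
  show "sgn a = inverse (norm a) *\<^sub>R a" by (rule sgn_ell2_def)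
  show "(uniformity :: ('a ell2 \<times> 'a ell2) filter) = (INF e\<in>{0<..}. principal {(x, y). dist x y < e})"
    by (rule uniformity_ell2_def)
  show "open U \<longleftrightarrow> (\<forall>x\<in>U. eventually (\<lambda>(x', y). x' = x \<longrightarrow> y \<in> U) uniformity)" for U :: "'a ell2 set"
    by (rule open_ell2_def)
  show "norm a = 0 \<longleftrightarrow> a = 0"
    by transfer (simp add: suminf_eq_zero_iff fun_eq_iff)
  show "norm (a + b) \<le> norm a + norm b"
    by transfer (rule square_summable_minkowski)
  show "norm (r *\<^sub>R a) = \<bar>r\<bar> * norm a"
    by transfer (simp add: power_mult_distrib suminf_mult real_sqrt_mult)
qed

end

instantiation ell2 :: (complex_normed_vector) complex_normed_vector
begin

lift_definition scaleC_ell2 :: "complex \<Rightarrow> 'a ell2 \<Rightarrow> 'a ell2" is "\<lambda>c a i. c *\<^sub>C a i"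
  by (simp add: norm_scaleC power_mult_distrib summable_mult)

instance
proof
  fix a b :: "'a ell2" and c d :: complex and r :: real
  show "c *\<^sub>C (a + b) = c *\<^sub>C a + c *\<^sub>C b" by transfer (simp add: scaleC_add_right)
  show "(c + d) *\<^sub>C a = c *\<^sub>C a + d *\<^sub>C a" by transfer (simp add: scaleC_add_left)
  show "c *\<^sub>C d *\<^sub>C a = (c * d) *\<^sub>C a" by transfer (simp add: scaleC_scaleC)
  show "complex_of_real r *\<^sub>C a = r *\<^sub>R a" by transfer (simp add: scaleC_of_real)
  show "norm (c *\<^sub>C a) = norm c * norm a"
    by transfer (simp add: norm_scaleC power_mult_distrib suminf_mult real_sqrt_mult)
qed

end

definition ell2_inner :: "'b::unital_cstar_algebra ell2 \<Rightarrow> 'b ell2 \<Rightarrow> 'b"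
  where "ell2_inner a b = (\<Sum>i. star (ell2_nth b i) * ell2_nth a i)"

lift_definition ell2_rmult :: "'b::real_normed_algebra ell2 \<Rightarrow> 'b \<Rightarrow> 'b ell2" is "\<lambda>a b i. a i * b"
  subgoal for a b
    by (rule summable_comparison_test[OF _ summable_mult[of _ "(norm b)\<^sup>2"]], rule exI[of _ 0])
       (auto simp flip: power_mult_distrib simp: mult.commute[of "norm b"] intro!: power_mono norm_mult_ineq)
  done


section \<open>Bounded operators\<close>

text \<open>The library's bounded operators are only real linear. The algebra \<open>\<U>\<close> is
  the (norm closed) subalgebra of those that are complex linear.\<close>

definition bounded_ops :: "('b::complex_normed_vector ell2 \<Rightarrow>\<^sub>L 'b ell2) set"  ("\<U>")
  where "\<U> = {T. \<forall>c x. blinfun_apply T (c *\<^sub>C x) = c *\<^sub>C blinfun_apply T x}"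

definition invertible_op :: "('b::complex_normed_vector ell2 \<Rightarrow>\<^sub>L 'b ell2) \<Rightarrow> bool"
  where "invertible_op X \<longleftrightarrow>
    X \<in> \<U> \<and> (\<exists>Y\<in>\<U>. X o\<^sub>L Y = id_blinfun \<and> Y o\<^sub>L X = id_blinfun)"

lemma bounded_linear_scaleC: "bounded_linear (\<lambda>x :: 'a::complex_normed_vector. c *\<^sub>C x)"
proof (rule bounded_linear_intro[where K = "norm c"])
  fix x y :: 'a and r :: real
  show "c *\<^sub>C (x + y) = c *\<^sub>C x + c *\<^sub>C y" by (rule scaleC_add_right)
  show "c *\<^sub>C r *\<^sub>R x = r *\<^sub>R c *\<^sub>C x"
    by (simp add: scaleC_scaleC mult.commute flip: scaleC_of_real)
  show "norm (c *\<^sub>C x) \<le> norm x * norm c" by (simp add: norm_scaleC)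
qed

instantiation blinfun :: (real_normed_vector, complex_normed_vector) complex_normed_vector
begin

definition scaleC_blinfun :: "complex \<Rightarrow> ('a \<Rightarrow>\<^sub>L 'b) \<Rightarrow> ('a \<Rightarrow>\<^sub>L 'b)"
  where "scaleC_blinfun c T = Blinfun (\<lambda>x. c *\<^sub>C blinfun_apply T x)"

lemma blinfun_apply_scaleC: "blinfun_apply (c *\<^sub>C T) x = c *\<^sub>C blinfun_apply T x"
  for T :: "'a \<Rightarrow>\<^sub>L 'b"
  unfolding scaleC_blinfun_def
  by (subst bounded_linear_Blinfun_apply)
     (auto intro: bounded_linear_compose[OF bounded_linear_scaleC] blinfun.bounded_linear_right)

instance
proof
  fix S T :: "'a \<Rightarrow>\<^sub>L 'b" and c d :: complex and r :: real
  show "c *\<^sub>C (S + T) = c *\<^sub>C S + c *\<^sub>C T"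
    by (rule blinfun_eqI) (simp add: blinfun_apply_scaleC blinfun.add_left scaleC_add_right)
  show "(c + d) *\<^sub>C T = c *\<^sub>C T + d *\<^sub>C T"
    by (rule blinfun_eqI) (simp add: blinfun_apply_scaleC blinfun.add_left scaleC_add_left)
  show "c *\<^sub>C d *\<^sub>C T = (c * d) *\<^sub>C T"
    by (rule blinfun_eqI) (simp add: blinfun_apply_scaleC scaleC_scaleC)
  show "complex_of_real r *\<^sub>C T = r *\<^sub>R T"
    by (rule blinfun_eqI) (simp add: blinfun_apply_scaleC blinfun.scaleR_left scaleC_of_real)
  have le: "norm (c *\<^sub>C T) \<le> norm c * norm T" for c and T :: "'a \<Rightarrow>\<^sub>L 'b"
    by (rule norm_blinfun_bound)
       (auto simp: blinfun_apply_scaleC norm_scaleC mult.assoc intro!: mult_left_mono norm_blinfun)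
  show "norm (c *\<^sub>C T) = norm c * norm T"
  proof (cases "c = 0")
    case True
    then show ?thesis using le[of c T] by simp
  next
    case False
    have "inverse c *\<^sub>C c *\<^sub>C T = T"
      using False by (intro blinfun_eqI)
        (simp add: blinfun_apply_scaleC scaleC_scaleC scaleC_of_real[of 1, simplified])
    then have "norm T \<le> norm (inverse c) * norm (c *\<^sub>C T)"
      using le[of "inverse c" "c *\<^sub>C T"] by simp
    then have "norm c * norm T \<le> norm (c *\<^sub>C T)"
      using False by (simp add: norm_divide field_simps)
    with le[of c T] show ?thesis by simp
  qed
qed

end


section \<open>Holomorphic maps and iterated Wirtinger derivatives\<close>

definition holomorphic_map_on ::
    "(complex^'m \<Rightarrow> 'a::complex_normed_vector) \<Rightarrow> (complex^'m) set \<Rightarrow> bool"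
  where "holomorphic_map_on f \<Omega> \<longleftrightarrow>
    (\<forall>z\<in>\<Omega>. \<exists>D. (f has_derivative D) (at z) \<and> (\<forall>c v. D (c *s v) = c *\<^sub>C D v))"

text \<open>With \<open>z\<^sub>j = x\<^sub>j + \<i> y\<^sub>j\<close>, the Wirtinger derivatives are \<open>\<partial>\<^sub>j = (\<partial>/\<partial>x\<^sub>j - \<i> \<partial>/\<partial>y\<^sub>j)/2\<close> and its
  conjugate analogue \<open>(\<partial>/\<partial>x\<^sub>j + \<i> \<partial>/\<partial>y\<^sub>j)/2\<close>. Derivatives are total functions here, with value 0
  at points where the map is not real differentiable. This case does not arise on \<open>\<Omega>\<close> for
  the maps \<open>\<I>\<close> considered below and their iterated derivatives: each \<open>\<I>\<close> is composed of
  holomorphic and antiholomorphic maps and an inversion in Banach algebras, so it is smooth.\<close>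

definition wirtinger :: "'m \<Rightarrow> (complex^'m \<Rightarrow> 'a::complex_normed_vector) \<Rightarrow> complex^'m \<Rightarrow> 'a"
  where "wirtinger j f z =
    (if f differentiable (at z)
     then (1/2) *\<^sub>C (frechet_derivative f (at z) (axis j 1)
                    - \<i> *\<^sub>C frechet_derivative f (at z) (axis j \<i>))
     else 0)"

definition wirtinger_bar :: "'m \<Rightarrow> (complex^'m \<Rightarrow> 'a::complex_normed_vector) \<Rightarrow> complex^'m \<Rightarrow> 'a"
  where "wirtinger_bar j f z =
    (if f differentiable (at z)
     then (1/2) *\<^sub>C (frechet_derivative f (at z) (axis j 1)
                    + \<i> *\<^sub>C frechet_derivative f (at z) (axis j \<i>))
     else 0)"

text \<open>The linear order on the index type fixes the order of the coordinates, so that with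
  \<open>UNIV = {1 < \<dots> < m}\<close> the following are \<open>\<partial>\<^sub>1\<^bsup>I\<^sub>1\<^esup> (\<dots> (\<partial>\<^sub>m\<^bsup>I\<^sub>m\<^esup> f))\<close> and its conjugate analogue.\<close>

definition multi_deriv ::
    "nat^'m::{finite,linorder} \<Rightarrow> (complex^'m::{finite,linorder} \<Rightarrow> 'a::complex_normed_vector) \<Rightarrow>
      complex^'m::{finite,linorder} \<Rightarrow> 'a"
  where "multi_deriv I f = foldr (\<lambda>j. wirtinger j ^^ (I $ j)) (sorted_list_of_set UNIV) f"

definition multi_deriv_bar ::
    "nat^'m::{finite,linorder} \<Rightarrow> (complex^'m::{finite,linorder} \<Rightarrow> 'a::complex_normed_vector) \<Rightarrow>
      complex^'m::{finite,linorder} \<Rightarrow> 'a"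
  where "multi_deriv_bar J f = foldr (\<lambda>j. wirtinger_bar j ^^ (J $ j)) (sorted_list_of_set UNIV) f"


section \<open>The class \<open>\<I>\<^sub>n(\<Omega>, \<U>)\<close> and similarity\<close>

definition frame_map :: "('b::unital_cstar_algebra ell2)^'n \<Rightarrow> 'b^'n \<Rightarrow> 'b ell2"
  where "frame_map F \<xi> = (\<Sum>i\<in>UNIV. ell2_rmult (F $ i) (\<xi> $ i))"

definition coframe_map :: "('b::unital_cstar_algebra ell2)^'n \<Rightarrow> 'b ell2 \<Rightarrow> 'b^'n"
  where "coframe_map G x = (\<chi> i. ell2_inner x (G $ i))"

definition gram :: "('b::unital_cstar_algebra ell2)^'n \<Rightarrow> ('b ell2)^'n \<Rightarrow> 'b^'n^'n"
  where "gram G F = (\<chi> i j. ell2_inner (F $ j) (G $ i))"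

text \<open>The number \<open>n\<close> is the cardinality of the index type \<open>'n\<close>. Elements are represented by total
  functions, of which only the values on \<open>\<Omega>\<close> matter.\<close>

definition idempotent_maps ::
    "'n::finite itself \<Rightarrow> (complex^'m) set \<Rightarrow>
      (complex^'m \<Rightarrow> ('b::unital_cstar_algebra ell2 \<Rightarrow>\<^sub>L 'b ell2)) set"
  where "idempotent_maps _ \<Omega> =
    {\<I>. \<exists>F G :: complex^'m \<Rightarrow> ('b ell2)^'n.
      (\<forall>i. holomorphic_map_on (\<lambda>z. F z $ i) \<Omega>) \<and>
      (\<forall>i. holomorphic_map_on (\<lambda>z. G z $ i) \<Omega>) \<and>
      (\<forall>z\<in>\<Omega>. invertible (gram (G z) (F z)) \<and> \<I> z \<in> \<U> \<and>
        (\<forall>x. blinfun_apply (\<I> z) x =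
          frame_map (F z) (matrix_inv (gram (G z) (F z)) *v coframe_map (G z) x)))}"

definition similar_on ::
    "'p set \<Rightarrow> ('p \<Rightarrow> ('b::complex_normed_vector ell2 \<Rightarrow>\<^sub>L 'b ell2)) \<Rightarrow>
      ('p \<Rightarrow> ('b ell2 \<Rightarrow>\<^sub>L 'b ell2)) \<Rightarrow> bool"
  where "similar_on \<Omega> \<I>\<^sub>1 \<I>\<^sub>2 \<longleftrightarrow>
    (\<exists>X. invertible_op X \<and> (\<forall>z\<in>\<Omega>. X o\<^sub>L \<I>\<^sub>1 z = \<I>\<^sub>2 z o\<^sub>L X))"

end

theory Submission
  imports Defs
begin

text \<open>Conjugation by an invertible \<open>X \<in> \<U>\<close> is a complex linear homeomorphism of the space of
  operators, and such maps commute with every Wirtinger derivative; the default value 0 at points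
  of non-differentiability respects this, since a map and its image under the homeomorphism are
  differentiable at the same points. Hence \<open>X \<I>\<^sub>1 = \<I>\<^sub>2 X\<close> on the open set \<open>\<Omega>\<close> gives \<open>X D\<^sup>I\<I>\<^sub>1 = D\<^sup>I\<I>\<^sub>2 X\<close> there, likewise for
  the conjugate derivatives (\<open>multi_deriv_intertwining\<close>), and the two relations compose to (2).

  Conversely, (2) with \<open>I = J = 0\<close> reads \<open>X \<I>\<^sub>1\<^sup>2 = \<I>\<^sub>2\<^sup>2 X\<close>, which is the similarity relation
  because the values of the maps are idempotent (\<open>idempotent_maps_idem\<close>). That in turn is the
  cancellation \<open>F (G\<^sup>*F)\<^sup>-\<^sup>1 (G\<^sup>*F) (G\<^sup>*F)\<^sup>-\<^sup>1 G\<^sup>* = F (G\<^sup>*F)\<^sup>-\<^sup>1 G\<^sup>*\<close>; it needs that the Gram matrix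
  represents \<open>G\<^sup>*F\<close>, that is, that the \<open>B\<close>-valued inner product is right \<open>B\<close>-linear in its first
  argument, for which its defining series has to converge.\<close>

text \<open>The \<open>C\<^sup>*\<close>-identity gives \<open>\<parallel>a\<parallel>\<^sup>2 \<le> \<parallel>a\<^sup>*\<parallel> \<parallel>a\<parallel>\<close>, so \<open>\<parallel>a\<parallel> \<le> \<parallel>a\<^sup>*\<parallel>\<close>; applying this to \<open>b\<close>
  and to \<open>b\<^sup>*\<close> gives both inequalities.\<close>

lemma norm_star: "norm (star b) = norm (b :: 'b::unital_cstar_algebra)"
proof -
  have le: "norm a \<le> norm (star a)" for a :: 'b
  proof (cases "norm a = 0")
    case False
    have "(norm a)\<^sup>2 \<le> norm (star a) * norm a"
      using norm_mult_ineq[of "star a" a] by (simp add: cstar_identity)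
    with False show ?thesis
      by (simp add: power2_eq_square)
  qed simp
  from le[of b] le[of "star b"] show ?thesis
    by (simp add: star_star)
qed

lemma summable_ell2_inner:
  "summable (\<lambda>i. star (ell2_nth b i) * ell2_nth a i)" for a b :: "'b::unital_cstar_algebra ell2"
proof (rule summable_comparison_test')
  have "summable (\<lambda>i. (norm (ell2_nth c i))\<^sup>2)" for c :: "'b ell2"
    using ell2_nth[of c] by simp
  then show "summable (\<lambda>i. (norm (ell2_nth b i))\<^sup>2 + (norm (ell2_nth a i))\<^sup>2)"
    by (intro summable_add)
  fix i :: nat
  have "norm (star (ell2_nth b i) * ell2_nth a i) \<le> norm (ell2_nth b i) * norm (ell2_nth a i)"
    by (metis norm_mult_ineq norm_star)
  also have "\<dots> \<le> (norm (ell2_nth b i))\<^sup>2 + (norm (ell2_nth a i))\<^sup>2"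
    using sum_squares_bound[of "norm (ell2_nth b i)" "norm (ell2_nth a i)"]
      mult_nonneg_nonneg[OF norm_ge_zero norm_ge_zero, of "ell2_nth b i" "ell2_nth a i"]
    unfolding mult.assoc by linarith
  finally show "norm (star (ell2_nth b i) * ell2_nth a i)
      \<le> (norm (ell2_nth b i))\<^sup>2 + (norm (ell2_nth a i))\<^sup>2" .
qed

lemma ell2_inner_add_left: "ell2_inner (a + a') b = ell2_inner a b + ell2_inner a' b"
  by (simp add: ell2_inner_def plus_ell2.rep_eq ring_distribs suminf_add summable_ell2_inner)

lemma ell2_inner_zero_left: "ell2_inner 0 b = 0"
  by (simp add: ell2_inner_def zero_ell2.rep_eq)

lemma ell2_inner_sum_left: "ell2_inner (\<Sum>i\<in>A. f i) b = (\<Sum>i\<in>A. ell2_inner (f i) b)"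
  by (induction A rule: infinite_finite_induct)
    (simp_all add: ell2_inner_add_left ell2_inner_zero_left)

lemma ell2_inner_rmult_left: "ell2_inner (ell2_rmult a c) b = ell2_inner a b * c"
  by (simp add: ell2_inner_def ell2_rmult.rep_eq suminf_mult2[OF summable_ell2_inner] mult.assoc)

text \<open>The coefficients in \<open>\<Sum>\<^sub>j F\<^sub>j \<xi>\<^sub>j\<close> stand on the right, and the inner product
  \<open>\<Sum>\<^sub>i b\<^sub>i\<^sup>*a\<^sub>i\<close> lets them out on the right, as the matrix product over the noncommutative ring
  \<open>B\<close> requires.\<close>

lemma coframe_frame_map: "coframe_map G (frame_map F \<xi>) = gram G F *v \<xi>"
  by (simp add: coframe_map_def frame_map_def gram_def matrix_vector_mult_def
      ell2_inner_sum_left ell2_inner_rmult_left)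

lemma idempotent_maps_idem:
  assumes "\<I> \<in> idempotent_maps TYPE('n::finite) \<Omega>" and "z \<in> \<Omega>"
  shows "\<I> z o\<^sub>L \<I> z = \<I> z"
proof -
  obtain F G :: "complex^'a \<Rightarrow> ('b ell2)^'n"
    where inv: "invertible (gram (G z) (F z))"
      and \<I>: "\<And>x. blinfun_apply (\<I> z) x =
          frame_map (F z) (matrix_inv (gram (G z) (F z)) *v coframe_map (G z) x)"
    using assms unfolding idempotent_maps_def by blast
  have "gram (G z) (F z) ** matrix_inv (gram (G z) (F z)) = mat 1"
    using inv unfolding invertible_def matrix_inv_def by (rule someI2_ex) blast
  then show ?thesis
    by (intro blinfun_eqI) (simp add: \<I> coframe_frame_map matrix_vector_mul_assoc)
qed

lemma has_derivative_bounded_linear_image: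
  assumes "bounded_linear L" and "open \<Omega>" and "z \<in> \<Omega>" and "\<And>w. w \<in> \<Omega> \<Longrightarrow> g w = L (f w)"
    and "(f has_derivative D) (at z)"
  shows "(g has_derivative (\<lambda>v. L (D v))) (at z)"
  by (rule has_derivative_transform_within_open[OF bounded_linear.has_derivative[OF assms(1,5)]])
    (use assms in auto)

text \<open>The inverse serves only to carry differentiability back from \<open>g\<close> to \<open>f\<close>, which matters
  because the Wirtinger derivatives have a default value at the other points.\<close>

locale complex_linear_homeomorphism =
  fixes L :: "'a::complex_normed_vector \<Rightarrow> 'b::complex_normed_vector" and L' :: "'b \<Rightarrow> 'a"
  assumes bounded_linear: "bounded_linear L"
    and bounded_linear_inverse: "bounded_linear L'"
    and left_inverse: "L' (L x) = x"
    and scaleC: "L (c *\<^sub>C x) = c *\<^sub>C L x"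
begin

context
  fixes \<Omega> :: "(complex^'m) set" and f g
  assumes \<Omega>: "open \<Omega>" and g: "\<And>w. w \<in> \<Omega> \<Longrightarrow> g w = L (f w)"
begin

lemma differentiable_iff: "z \<in> \<Omega> \<Longrightarrow> g differentiable (at z) \<longleftrightarrow> f differentiable (at z)"
  using has_derivative_bounded_linear_image[OF bounded_linear \<Omega>, of z g f]
    has_derivative_bounded_linear_image[OF bounded_linear_inverse \<Omega>, of z f g]
  unfolding differentiable_def by (metis g left_inverse)

lemma frechet_derivative_image:
  assumes "z \<in> \<Omega>" and "f differentiable (at z)"
  shows "frechet_derivative g (at z) v = L (frechet_derivative f (at z) v)"
  using has_derivative_bounded_linear_image[OF bounded_linear \<Omega> assms(1) g
      assms(2)[unfolded frechet_derivative_works]]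
  by (simp add: frechet_derivative_at[symmetric])

lemma wirtinger_image: "z \<in> \<Omega> \<Longrightarrow> wirtinger j g z = L (wirtinger j f z)"
  by (simp add: wirtinger_def differentiable_iff frechet_derivative_image scaleC
      linear_diff linear_0 bounded_linear.linear[OF bounded_linear])

lemma wirtinger_bar_image: "z \<in> \<Omega> \<Longrightarrow> wirtinger_bar j g z = L (wirtinger_bar j f z)"
  by (simp add: wirtinger_bar_def differentiable_iff frechet_derivative_image scaleC
      linear_add linear_0 bounded_linear.linear[OF bounded_linear])

end

text \<open>The hypothesis on \<open>D\<close> concerns all pairs of maps related by \<open>L\<close> on the whole of \<open>\<Omega>\<close>, and so
  does its conclusion; this is what makes it iterate.\<close>

lemma foldr_funpow_image:
  assumes D: "\<And>j f g z. (\<And>w. w \<in> \<Omega> \<Longrightarrow> g w = L (f w)) \<Longrightarrow> z \<in> \<Omega> \<Longrightarrow> D' j g z = L (D j f z)"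
    and g: "\<And>w. w \<in> \<Omega> \<Longrightarrow> g w = L (f w)" and z: "z \<in> \<Omega>"
  shows "foldr (\<lambda>j. D' j ^^ k j) js g z = L (foldr (\<lambda>j. D j ^^ k j) js f z)"
proof -
  have pow: "(D' j ^^ n) g z = L ((D j ^^ n) f z)"
    if "\<And>w. w \<in> \<Omega> \<Longrightarrow> g w = L (f w)" and "z \<in> \<Omega>" for j n f g z
    using that by (induction n arbitrary: z) (simp_all add: D)
  show ?thesis
    using z by (induction js arbitrary: z) (simp_all add: g pow)
qed

lemma
  fixes \<Omega> :: "(complex^'m::{finite,linorder}) set"
  assumes "open \<Omega>" and "\<And>w. w \<in> \<Omega> \<Longrightarrow> g w = L (f w)" and "z \<in> \<Omega>"
  shows multi_deriv_image: "multi_deriv I g z = L (multi_deriv I f z)"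
    and multi_deriv_bar_image: "multi_deriv_bar I g z = L (multi_deriv_bar I f z)"
proof -
  show "multi_deriv I g z = L (multi_deriv I f z)"
    unfolding multi_deriv_def
    by (rule foldr_funpow_image[where \<Omega> = \<Omega> and D = wirtinger and D' = wirtinger])
      (assumption | rule wirtinger_image[OF assms(1)] assms(2,3))+
  show "multi_deriv_bar I g z = L (multi_deriv_bar I f z)"
    unfolding multi_deriv_bar_def
    by (rule foldr_funpow_image[where \<Omega> = \<Omega> and D = wirtinger_bar and D' = wirtinger_bar])
      (assumption | rule wirtinger_bar_image[OF assms(1)] assms(2,3))+
qed

end

lemma conjugation_homeomorphism:
  assumes "X \<in> \<U>" and "Y o\<^sub>L X = id_blinfun"
  shows "complex_linear_homeomorphism (\<lambda>T. X o\<^sub>L (T o\<^sub>L Y)) (\<lambda>T. Y o\<^sub>L (T o\<^sub>L X))"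
proof (rule complex_linear_homeomorphism.intro)
  have bl: "bounded_linear (\<lambda>T. A o\<^sub>L (T o\<^sub>L C))" for A C :: "'a ell2 \<Rightarrow>\<^sub>L 'a ell2"
    by (intro bounded_linear_intros)
  show "bounded_linear (\<lambda>T. X o\<^sub>L (T o\<^sub>L Y))" "bounded_linear (\<lambda>T. Y o\<^sub>L (T o\<^sub>L X))"
    by (rule bl)+
  have YX: "blinfun_apply Y (blinfun_apply X x) = x" for x
    using arg_cong[OF assms(2), of "\<lambda>T. blinfun_apply T x"] by simp
  show "Y o\<^sub>L ((X o\<^sub>L (T o\<^sub>L Y)) o\<^sub>L X) = T" for T
    by (rule blinfun_eqI) (simp add: YX)
  show "X o\<^sub>L ((c *\<^sub>C T) o\<^sub>L Y) = c *\<^sub>C (X o\<^sub>L (T o\<^sub>L Y))" for c T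
    using assms(1) by (intro blinfun_eqI) (simp add: blinfun_apply_scaleC bounded_ops_def)
qed

lemma
  fixes \<Omega> :: "(complex^'m::{finite,linorder}) set"
  assumes X: "invertible_op X" and \<Omega>: "open \<Omega>"
    and fg: "\<And>w. w \<in> \<Omega> \<Longrightarrow> X o\<^sub>L f w = g w o\<^sub>L X" and z: "z \<in> \<Omega>"
  shows multi_deriv_intertwining: "X o\<^sub>L multi_deriv I f z = multi_deriv I g z o\<^sub>L X"
    and multi_deriv_bar_intertwining: "X o\<^sub>L multi_deriv_bar I f z = multi_deriv_bar I g z o\<^sub>L X"
proof -
  obtain Y where "X \<in> \<U>" and XY: "X o\<^sub>L Y = id_blinfun" and YX: "Y o\<^sub>L X = id_blinfun"
    using X unfolding invertible_op_def by blast
  then interpret complex_linear_homeomorphism "\<lambda>T. X o\<^sub>L (T o\<^sub>L Y)" "\<lambda>T. Y o\<^sub>L (T o\<^sub>L X)"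
    by (intro conjugation_homeomorphism)
  have cancel: "blinfun_apply Y (blinfun_apply X x) = x" "blinfun_apply X (blinfun_apply Y x) = x" for x
    using arg_cong[OF YX, of "\<lambda>T. blinfun_apply T x"] arg_cong[OF XY, of "\<lambda>T. blinfun_apply T x"]
    by simp_all
  have g: "g w = X o\<^sub>L (f w o\<^sub>L Y)" if "w \<in> \<Omega>" for w
  proof (rule blinfun_eqI)
    fix x
    show "blinfun_apply (g w) x = blinfun_apply (X o\<^sub>L (f w o\<^sub>L Y)) x"
      using arg_cong[OF fg[OF that], of "\<lambda>T. blinfun_apply T (blinfun_apply Y x)"]
      by (simp add: cancel)
  qed
  show "X o\<^sub>L multi_deriv I f z = multi_deriv I g z o\<^sub>L X"
    "X o\<^sub>L multi_deriv_bar I f z = multi_deriv_bar I g z o\<^sub>L X"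
    by (rule blinfun_eqI;
        simp add: multi_deriv_image[OF \<Omega> g z] multi_deriv_bar_image[OF \<Omega> g z] cancel)+
qed

lemma
  fixes f :: "complex^'m::{finite,linorder} \<Rightarrow> 'a::complex_normed_vector"
  shows multi_deriv_0: "multi_deriv 0 f = f" and multi_deriv_bar_0: "multi_deriv_bar 0 f = f"
proof -
  have "foldr (\<lambda>_. id) js f = f" for js :: "'m list"
    by (induction js) simp_all
  then show "multi_deriv 0 f = f" "multi_deriv_bar 0 f = f"
    by (simp_all add: multi_deriv_def multi_deriv_bar_def id_def)
qed

theorem lemma2p16:
  fixes \<Omega> :: "(complex^'m::{finite,linorder}) set"
    and \<I>\<^sub>1 \<I>\<^sub>2 :: "complex^'m::{finite,linorder} \<Rightarrow> ('b::unital_cstar_algebra ell2 \<Rightarrow>\<^sub>L 'b ell2)"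
  assumes "open \<Omega>" and "connected \<Omega>" and "\<Omega> \<noteq> {}"
    and "\<I>\<^sub>1 \<in> idempotent_maps TYPE('n::finite) \<Omega>"
    and "\<I>\<^sub>2 \<in> idempotent_maps TYPE('n::finite) \<Omega>"
  shows "similar_on \<Omega> \<I>\<^sub>1 \<I>\<^sub>2 \<longleftrightarrow>
    (\<exists>X. invertible_op X \<and>
      (\<forall>z\<in>\<Omega>. \<forall>I J :: nat^'m::{finite,linorder}.
        X o\<^sub>L (multi_deriv I \<I>\<^sub>1 z o\<^sub>L multi_deriv_bar J \<I>\<^sub>1 z) =
        (multi_deriv I \<I>\<^sub>2 z o\<^sub>L multi_deriv_bar J \<I>\<^sub>2 z) o\<^sub>L X))"
proof
  assume "similar_on \<Omega> \<I>\<^sub>1 \<I>\<^sub>2"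
  then obtain X where X: "invertible_op X" and sim: "\<And>z. z \<in> \<Omega> \<Longrightarrow> X o\<^sub>L \<I>\<^sub>1 z = \<I>\<^sub>2 z o\<^sub>L X"
    unfolding similar_on_def by blast
  note intertwining = multi_deriv_intertwining[OF X \<open>open \<Omega>\<close> sim]
    multi_deriv_bar_intertwining[OF X \<open>open \<Omega>\<close> sim]
  have "X o\<^sub>L (multi_deriv I \<I>\<^sub>1 z o\<^sub>L multi_deriv_bar J \<I>\<^sub>1 z) =
      (multi_deriv I \<I>\<^sub>2 z o\<^sub>L multi_deriv_bar J \<I>\<^sub>2 z) o\<^sub>L X" if "z \<in> \<Omega>" for z I J
  proof (rule blinfun_eqI)
    fix x
    have "blinfun_apply X (blinfun_apply (multi_deriv I \<I>\<^sub>1 z) y) =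
        blinfun_apply (multi_deriv I \<I>\<^sub>2 z) (blinfun_apply X y)"
      "blinfun_apply X (blinfun_apply (multi_deriv_bar J \<I>\<^sub>1 z) y) =
        blinfun_apply (multi_deriv_bar J \<I>\<^sub>2 z) (blinfun_apply X y)" for y
      using intertwining[OF _ that, THEN arg_cong[where f = "\<lambda>T. blinfun_apply T y"]] by simp_all
    then show "blinfun_apply (X o\<^sub>L (multi_deriv I \<I>\<^sub>1 z o\<^sub>L multi_deriv_bar J \<I>\<^sub>1 z)) x =
        blinfun_apply ((multi_deriv I \<I>\<^sub>2 z o\<^sub>L multi_deriv_bar J \<I>\<^sub>2 z) o\<^sub>L X) x"
      by simp
  qed
  with X show "\<exists>X. invertible_op X \<and> (\<forall>z\<in>\<Omega>. \<forall>I J.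
      X o\<^sub>L (multi_deriv I \<I>\<^sub>1 z o\<^sub>L multi_deriv_bar J \<I>\<^sub>1 z) =
      (multi_deriv I \<I>\<^sub>2 z o\<^sub>L multi_deriv_bar J \<I>\<^sub>2 z) o\<^sub>L X)"
    by blast
next
  assume "\<exists>X. invertible_op X \<and> (\<forall>z\<in>\<Omega>. \<forall>I J.
      X o\<^sub>L (multi_deriv I \<I>\<^sub>1 z o\<^sub>L multi_deriv_bar J \<I>\<^sub>1 z) =
      (multi_deriv I \<I>\<^sub>2 z o\<^sub>L multi_deriv_bar J \<I>\<^sub>2 z) o\<^sub>L X)"
  then obtain X where X: "invertible_op X" and eq: "\<And>z I J. z \<in> \<Omega> \<Longrightarrow>
      X o\<^sub>L (multi_deriv I \<I>\<^sub>1 z o\<^sub>L multi_deriv_bar J \<I>\<^sub>1 z) =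
      (multi_deriv I \<I>\<^sub>2 z o\<^sub>L multi_deriv_bar J \<I>\<^sub>2 z) o\<^sub>L X"
    by blast
  have "X o\<^sub>L \<I>\<^sub>1 z = \<I>\<^sub>2 z o\<^sub>L X" if "z \<in> \<Omega>" for z
    using eq[OF that, of 0 0] that
    by (simp add: multi_deriv_0 multi_deriv_bar_0 idempotent_maps_idem[OF assms(4)]
        idempotent_maps_idem[OF assms(5)])
  with X show "similar_on \<Omega> \<I>\<^sub>1 \<I>\<^sub>2"
    unfolding similar_on_def by blast
qed

end
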